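(* Let $\{W_1,W_2,\dots,W_m\}$ be a (nonempty) set of mutually unbiased weighing matrices of order $n$ and weight $k\ge 1$. Let $p$ be a prime number dividing $\sqrt k$ (in particular $\sqrt k$ is an integer), and let $q=p^r$ for a positive integer $r$. Let $\overline{\mathcal W}$ be the matrix algebra over $\mathbb F_q$ generated by $W_1,\dots,W_m$. Then the set of row spaces of the matrices $$\left[\begin{array}{c|c} X & \alpha I_n\end{array}\right],\qquad X\in\overline{\mathcal W}\setminus\{0\},\ \alpha\in\mathbb F_q\setminus\{0\},$$ is an LCD subspace code $C_S$ of subspaces of $\mathbb F_q^{2n}$.
   Context: A weighing matrix of order $n$ and weight $k$ is an $n\times n$ matrix $W$ with entries in $\{-1,0,1\}$ such that $WW^\top=kI_n$. Two weighing matrices $W_1,W_2$ of order $n$ and weight $k$ are unbiased if $W_1W_2^\top=\sqrt k\,W$ for some weighing matrix $W$ of order $n$ and weight $k$; a set of weighing matrices is mutually unbiased if any two distinct members are unbiased. The integer matrices $W_i$ are reduced modulo $p$ and regarded as matrices over $\mathbb F_q$. The matrix algebra generated by a set of matrices is the $\mathbb F_q$-linear span of all finite products (of length at least one) of these matrices; the identity matrix is not adjoined. $I_n$ is the identity matrix of order $n$. A subspace code is a nonempty set of subspaces of a vector space $\mathbb F_q^N$. A subspace code $C_S$ is an LCD subspace code if $U\cap W^\perp=\{0\}$ for all $U,W\in C_S$ (including $U=W$), where $\perp$ is with respect to the Euclidean inner product. *)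

theory Defs
  imports "HOL-Analysis.Analysis" "HOL-Computational_Algebra.Primes"
begin

definition weighing_matrix :: "nat \<Rightarrow> int ^ 'n ^ 'n \<Rightarrow> bool" where
  "weighing_matrix k W \<longleftrightarrow>
     (\<forall>i j. W $ i $ j \<in> {-1, 0, 1}) \<and> W ** transpose W = mat (int k)"

text \<open>The defining equation is stated over the reals, since \<open>sqrt k\<close> need not be an integer.\<close>

definition unbiased :: "nat \<Rightarrow> int ^ 'n ^ 'n \<Rightarrow> int ^ 'n ^ 'n \<Rightarrow> bool" where
  "unbiased k W\<^sub>1 W\<^sub>2 \<longleftrightarrow>
     (\<exists>W. weighing_matrix k W \<and>
        map_matrix real_of_int (W\<^sub>1 ** transpose W\<^sub>2) =
          sqrt (real k) *\<^sub>R map_matrix real_of_int W)"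

definition mutually_unbiased :: "nat \<Rightarrow> (int ^ 'n ^ 'n) set \<Rightarrow> bool" where
  "mutually_unbiased k S \<longleftrightarrow> (\<forall>W\<in>S. weighing_matrix k W) \<and> pairwise (unbiased k) S"

inductive_set matrix_products :: "('a::field ^ 'n ^ 'n) set \<Rightarrow> ('a ^ 'n ^ 'n) set"
  for S :: "('a ^ 'n ^ 'n) set" where
  single: "A \<in> S \<Longrightarrow> A \<in> matrix_products S"
| mult: "A \<in> matrix_products S \<Longrightarrow> B \<in> S \<Longrightarrow> A ** B \<in> matrix_products S"

interpretation mat_space: vector_space "\<lambda>c::'a::field. map_matrix ((*) c) :: 'a ^ 'n ^ 'm \<Rightarrow> 'a ^ 'n ^ 'm"
  by unfold_locales (simp_all add: vec_eq_iff algebra_simps)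

text \<open>Products have length at least one, so the algebra need not contain the identity matrix.\<close>

definition matrix_algebra :: "('a::field ^ 'n ^ 'n) set \<Rightarrow> ('a ^ 'n ^ 'n) set" where
  "matrix_algebra S = mat_space.span (matrix_products S)"

text \<open>The block matrix \<open>[A | B]\<close>; its columns are indexed by the disjoint sum of the two column
  index types, so that a row of \<open>[X | \<alpha> I]\<close> with \<open>X\<close> of order \<open>n\<close> has \<open>CARD('n + 'n) = 2 n\<close> entries.\<close>

definition hblock :: "'a ^ 'n ^ 'm \<Rightarrow> 'a ^ 'l ^ 'm \<Rightarrow> 'a ^ ('n + 'l) ^ 'm" where
  "hblock A B = (\<chi> i j. case j of Inl a \<Rightarrow> A $ i $ a | Inr b \<Rightarrow> B $ i $ b)"

definition row_space :: "'a::field ^ 'n ^ 'm \<Rightarrow> ('a ^ 'n) set" where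
  "row_space A = vec.span (rows A)"

definition euclidean_dual :: "('a::field ^ 'n) set \<Rightarrow> ('a ^ 'n) set" where
  "euclidean_dual U = {v. \<forall>u\<in>U. scalar_product u v = 0}"

definition subspace_code :: "('a::field ^ 'n) set set \<Rightarrow> bool" where
  "subspace_code C \<longleftrightarrow> C \<noteq> {} \<and> (\<forall>U\<in>C. vec.subspace U)"

definition LCD_subspace_code :: "('a::field ^ 'n) set set \<Rightarrow> bool" where
  "LCD_subspace_code C \<longleftrightarrow>
     subspace_code C \<and> (\<forall>U\<in>C. \<forall>W\<in>C. U \<inter> euclidean_dual W = {0})"

end

theory Submission
  imports Defs "HOL-Number_Theory.Residues"
begin

text \<open>
  The matrix of inner products between the rows of \<open>[X | \<alpha> I]\<close> and those of \<open>[Y | \<beta> I]\<close> is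
  \<open>X Y\<^sup>T + \<alpha> \<beta> I\<close>.  The point is that \<open>X Y\<^sup>T = 0\<close> for all members \<open>X, Y\<close> of the algebra
  (\<open>matrix_algebra_self_orthogonal\<close>), so that this matrix is a nonzero multiple of the identity.
  Then no nonzero vector \<open>x [X | \<alpha> I]\<close> is orthogonal to all rows of \<open>[Y | \<beta> I]\<close>, because its inner
  products with these rows are the coordinates of \<open>\<alpha> \<beta> x\<close>
  (\<open>row_space_Int_euclidean_dual\<close>).

  The vanishing of \<open>X Y\<^sup>T\<close> starts from the generators.  Put \<open>s = \<surd>k\<close>.  The entries of
  \<open>W\<^sub>i W\<^sub>j\<^sup>T\<close> are multiples of \<open>s\<close>, both for \<open>i \<noteq> j\<close>, where unbiasedness gives \<open>s W\<close>, and for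
  \<open>i = j\<close>, where the product is \<open>s\<^sup>2 I\<close>; hence they vanish modulo \<open>p\<close>.  For longer products,
  \<open>(A W\<^sub>i) (B W\<^sub>j)\<^sup>T = A (W\<^sub>i W\<^sub>j\<^sup>T) B\<^sup>T\<close>, so only the last factors matter, and the general case
  follows by bilinearity.  If the identity matrix were adjoined, this would fail, since
  \<open>W\<^sub>i I\<^sup>T = W\<^sub>i\<close> is nonzero.

  The code is nonempty because a nonzero entry of \<open>W\<^sub>i\<close> is \<open>1\<close> or \<open>-1\<close> and so survives the
  reduction modulo \<open>p\<close>.
\<close>

section \<open>Integer Gram matrices of mutually unbiased weighing matrices\<close>

text \<open>
  This weaker consequence of unbiasedness treats equal and distinct members alike, and it is all
  that survives modulo a divisor of \<open>s\<close>.
\<close>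

lemma mutually_unbiased_gram_dvd:
  fixes V W :: "int ^ 'n ^ 'n"
  assumes mu: "mutually_unbiased k S" and s: "real s = sqrt (real k)"
    and V: "V \<in> S" and W: "W \<in> S"
  shows "int s dvd (V ** transpose W) $ i $ j"
proof (cases "V = W")
  case True
  have "real k = real (s * s)"
    by (simp add: s)
  then have "k = s * s"
    by (simp only: of_nat_eq_iff)
  moreover have "V ** transpose W = mat (int k)"
    using mu V True by (simp add: mutually_unbiased_def weighing_matrix_def)
  ultimately show ?thesis
    by (simp add: mat_def)
next
  case False
  then have "unbiased k V W"
    using mu V W by (auto simp: mutually_unbiased_def pairwise_def)
  then obtain U where "map_matrix real_of_int (V ** transpose W) =
      sqrt (real k) *\<^sub>R map_matrix real_of_int U"
    by (auto simp: unbiased_def)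
  then have "map_matrix real_of_int (V ** transpose W) $ i $ j =
      (sqrt (real k) *\<^sub>R map_matrix real_of_int U) $ i $ j"
    by simp
  then have "real_of_int ((V ** transpose W) $ i $ j) = real_of_int (int s * U $ i $ j)"
    by (simp flip: s)
  then show ?thesis
    by (simp only: of_int_eq_iff dvd_triv_left)
qed

lemma weighing_matrix_reduction_nonzero:
  fixes W :: "int ^ 'n ^ 'n"
  assumes W: "weighing_matrix k W" and k: "k \<ge> 1"
  shows "map_matrix of_int W \<noteq> (0 :: 'a::field ^ 'n ^ 'n)"
proof
  assume eq: "map_matrix of_int W = (0 :: 'a ^ 'n ^ 'n)"
  have "W $ i $ j = 0" for i j
  proof -
    have "(of_int (W $ i $ j) :: 'a) = 0"
      using eq by (simp add: vec_eq_iff)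
    moreover have "W $ i $ j \<in> {-1, 0, 1}"
      using W by (simp add: weighing_matrix_def)
    ultimately show ?thesis
      by auto
  qed
  then have "W = 0"
    by (simp add: vec_eq_iff)
  then have "mat (int k) = (0 :: int ^ 'n ^ 'n)"
    using W by (simp add: weighing_matrix_def)
  then have "mat (int k) $ i $ i = (0 :: int ^ 'n ^ 'n) $ i $ i" for i
    by simp
  then show False
    using k by (simp add: mat_def)
qed

section \<open>Reduction to the finite field\<close>

lemma map_matrix_of_int_mult_transpose:
  "map_matrix of_int (A ** transpose B) =
     map_matrix of_int A ** transpose (map_matrix of_int B :: 'a::comm_ring_1 ^ 'n ^ 'm)"
  by (simp add: vec_eq_iff matrix_matrix_mult_def transpose_def)

text \<open>
  The additive order of \<open>1\<close> divides the number \<open>p\<^sup>r\<close> of elements, so \<open>p\<^sup>r\<close> vanishes in the field;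
  having no nilpotents, the field then satisfies \<open>p = 0\<close>.
\<close>

lemma of_nat_eq_0_if_CARD_eq_power:
  assumes "CARD('a::{field, finite}) = p ^ r"
  shows "of_nat p = (0 :: 'a)"
proof -
  have "of_nat (p ^ r) = (0 :: 'a)"
    using CHAR_dvd_CARD[where 'a = 'a] by (simp add: of_nat_eq_0_iff_char_dvd flip: assms)
  then show ?thesis
    by simp
qed

section \<open>Self-orthogonality of the generated algebra\<close>

text \<open>
  Since products are built by appending generators on the right, \<open>X Y\<^sup>T\<close> contains the vanishing
  product of the last factor of \<open>X\<close> and the transposed last factor of \<open>Y\<close>.  A case distinction
  on the last factor therefore suffices, without induction on the length.
\<close>

lemma matrix_products_self_orthogonal:
  assumes gen: "\<And>A B. A \<in> S \<Longrightarrow> B \<in> S \<Longrightarrow> A ** transpose B = 0"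
    and X: "X \<in> matrix_products S" and Y: "Y \<in> matrix_products S"
  shows "X ** transpose Y = 0"
proof -
  have left: "X ** transpose B = 0" if B: "B \<in> S" for B
    using X
  proof cases
    case single
    then show ?thesis using gen B by blast
  next
    case (mult A C)
    then show ?thesis
      using gen[OF _ B] by (simp flip: matrix_mul_assoc)
  qed
  from Y show ?thesis
  proof cases
    case single
    then show ?thesis using left by blast
  next
    case (mult A C)
    then show ?thesis
      using left by (simp add: matrix_transpose_mul matrix_mul_assoc)
  qed
qed

lemma subspace_left_annihilator:
  fixes Z :: "'a::field ^ 'l ^ 'n"
  shows "mat_space.subspace {X :: 'a ^ 'n ^ 'm. X ** Z = 0}"
proof -
  have add: "(X + Y) ** Z = X ** Z + Y ** Z" for X Y :: "'a ^ 'n ^ 'm"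
    by (simp add: vec_eq_iff matrix_matrix_mult_def distrib_right sum.distrib)
  have scale: "map_matrix ((*) c) X ** Z = map_matrix ((*) c) (X ** Z)"
    for c and X :: "'a ^ 'n ^ 'm"
    by (simp add: vec_eq_iff matrix_matrix_mult_def sum_distrib_left mult.assoc)
  show ?thesis
    by (simp add: mat_space.subspace_def add scale)
qed

lemma subspace_transpose_right_annihilator:
  fixes X :: "'a::field ^ 'n ^ 'l"
  shows "mat_space.subspace {Y :: 'a ^ 'n ^ 'm. X ** transpose Y = 0}"
proof -
  have "X ** transpose Y = 0 \<longleftrightarrow> Y ** transpose X = 0" for Y :: "'a ^ 'n ^ 'm"
  proof -
    have "Y ** transpose X = transpose (X ** transpose Y)"
      by (simp only: matrix_transpose_mul transpose_transpose)
    moreover have "transpose Z = 0 \<longleftrightarrow> Z = 0" for Z :: "'a ^ 'm ^ 'l"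
      by (auto simp: vec_eq_iff transpose_def)
    ultimately show ?thesis
      by simp
  qed
  then have "{Y :: 'a ^ 'n ^ 'm. X ** transpose Y = 0} = {Y. Y ** transpose X = 0}"
    by (intro Collect_cong)
  then show ?thesis
    using subspace_left_annihilator[of "transpose X"] by (rule ssubst)
qed

lemma matrix_algebra_self_orthogonal:
  assumes gen: "\<And>A B. A \<in> S \<Longrightarrow> B \<in> S \<Longrightarrow> A ** transpose B = 0"
    and X: "X \<in> matrix_algebra S" and Y: "Y \<in> matrix_algebra S"
  shows "X ** transpose Y = 0"
proof -
  have "matrix_algebra S \<subseteq> {X. X ** transpose Z = 0}" if "Z \<in> matrix_products S" for Z
    unfolding matrix_algebra_def
    using matrix_products_self_orthogonal[OF gen _ that]
    by (intro mat_space.span_minimal subspace_left_annihilator) auto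
  then have "matrix_products S \<subseteq> {Z. X ** transpose Z = 0}"
    using X by blast
  then have "matrix_algebra S \<subseteq> {Z. X ** transpose Z = 0}"
    unfolding matrix_algebra_def
    by (intro mat_space.span_minimal subspace_transpose_right_annihilator)
  then show ?thesis
    using Y by blast
qed

section \<open>Row spaces and their duals\<close>

lemma hblock_mult_transpose_hblock:
  "hblock A B ** transpose (hblock C D) = A ** transpose C + B ** transpose D"
  by (simp add: vec_eq_iff matrix_matrix_mult_def transpose_def hblock_def sum.Plus
      del: UNIV_Plus_UNIV flip: UNIV_Plus_UNIV)

lemma row_space_imp_vector_matrix_mult:
  assumes "v \<in> row_space A"
  obtains x where "v = x v* A"
proof -
  have "row i A = axis i 1 v* A" for i
    by (simp add: vec_eq_iff row_def vector_matrix_mult_def axis_def if_distribR if_distrib[of "\<lambda>x. x * _"] cong: if_cong)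
  then have "rows A \<subseteq> range (\<lambda>x. x v* A)"
    by (auto simp: rows_def)
  moreover have "vec.subspace (range (\<lambda>x. x v* A))"
    unfolding vec.subspace_def
  proof (safe)
    show "0 \<in> range (\<lambda>x. x v* A)"
      by (metis rangeI vector_matrix_mult_0)
  next
    fix x y
    show "x v* A + y v* A \<in> range (\<lambda>x. x v* A)"
      by (metis rangeI vector_matrix_left_distrib)
  next
    fix c x
    show "c *s (x v* A) \<in> range (\<lambda>x. x v* A)"
      by (metis rangeI scalar_vector_matrix_assoc)
  qed
  ultimately have "row_space A \<subseteq> range (\<lambda>x. x v* A)"
    unfolding row_space_def by (intro vec.span_minimal)
  then show ?thesis
    using assms that by blast
qed

lemma euclidean_dual_row_space_imp:
  assumes "v \<in> euclidean_dual (row_space B)"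
  shows "B *v v = 0"
proof -
  have "row i B \<in> row_space B" for i
    unfolding row_space_def by (rule vec.span_base) (auto simp: rows_def)
  then have "scalar_product (row i B) v = 0" for i
    using assms by (auto simp: euclidean_dual_def)
  then show ?thesis
    by (simp add: vec_eq_iff matrix_vector_mult_def scalar_product_def row_def)
qed

text \<open>
  The vector \<open>x A\<close> has inner products \<open>(B A\<^sup>T) x = c x\<close> with the rows of \<open>B\<close>, so it is orthogonal
  to all of them only for \<open>x = 0\<close>.
\<close>

lemma row_space_Int_euclidean_dual:
  fixes A B :: "'a::field ^ 'n ^ 'm"
  assumes gram: "B ** transpose A = mat c" and c: "c \<noteq> 0"
  shows "row_space A \<inter> euclidean_dual (row_space B) = {0}"
proof -
  have "v = 0" if vA: "v \<in> row_space A" and vB: "v \<in> euclidean_dual (row_space B)" for v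
  proof -
    obtain x where x: "v = x v* A"
      using vA by (rule row_space_imp_vector_matrix_mult)
    have "mat c *v x = B *v (transpose A *v x)"
      by (simp only: matrix_vector_mul_assoc gram)
    also have "\<dots> = 0"
      using euclidean_dual_row_space_imp[OF vB] x by simp
    finally have "x = 0"
      using c by (simp add: vec_eq_iff matrix_vector_mult_def mat_def if_distrib
          if_distribR cong: if_cong)
    then show ?thesis
      using x by simp
  qed
  moreover have "0 \<in> row_space A"
    by (simp add: row_space_def vec.span_zero)
  moreover have "0 \<in> euclidean_dual (row_space B)"
    by (simp add: euclidean_dual_def scalar_product_def)
  ultimately show ?thesis
    by blast
qed

section \<open>The subspace code\<close>

theorem theorem5:
  fixes \<W> :: "(int ^ 'n ^ 'n) set" and k s p r :: nat
    and \<A> :: "('a::{field, finite} ^ 'n ^ 'n) set"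
  assumes "finite \<W>" and "\<W> \<noteq> {}"
    and "k \<ge> 1"
    and "mutually_unbiased k \<W>"
    and "real s = sqrt (real k)"
    and "prime p" and "p dvd s"
    and "r > 0" and "CARD('a) = p ^ r"
    and "\<A> = matrix_algebra (map_matrix of_int ` \<W>)"
  shows "LCD_subspace_code
           {row_space (hblock X (mat \<alpha>)) | X \<alpha>. X \<in> \<A> - {0} \<and> \<alpha> \<in> UNIV - {0}}"
    (is "LCD_subspace_code ?C")
proof -
  let ?red = "map_matrix of_int :: int ^ 'n ^ 'n \<Rightarrow> 'a ^ 'n ^ 'n"
  have "(of_nat p :: 'a) = 0"
    using \<open>CARD('a) = p ^ r\<close> by (rule of_nat_eq_0_if_CARD_eq_power)
  then have s0: "(of_nat s :: 'a) = 0"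
    using \<open>p dvd s\<close> by (auto elim!: dvdE)
  have gen: "?red V ** transpose (?red W) = 0" if "V \<in> \<W>" "W \<in> \<W>" for V W
  proof -
    have "(of_int ((V ** transpose W) $ i $ j) :: 'a) = 0" for i j
      using mutually_unbiased_gram_dvd[OF assms(4,5) that, of i j] s0 by (auto elim!: dvdE)
    then have "?red (V ** transpose W) = 0"
      by (simp add: vec_eq_iff)
    then show ?thesis
      by (simp only: map_matrix_of_int_mult_transpose)
  qed
  have orth: "X ** transpose Y = 0" if "X \<in> \<A>" "Y \<in> \<A>" for X Y
  proof (rule matrix_algebra_self_orthogonal)
    show "X \<in> matrix_algebra (?red ` \<W>)" "Y \<in> matrix_algebra (?red ` \<W>)"
      using that by (simp_all only: assms(10))
    show "A ** transpose B = 0" if "A \<in> ?red ` \<W>" "B \<in> ?red ` \<W>" for A B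
      using that gen by blast
  qed
  obtain W where W: "W \<in> \<W>"
    using \<open>\<W> \<noteq> {}\<close> by blast
  then have "?red W \<in> \<A>"
    unfolding assms(10) matrix_algebra_def
    by (intro mat_space.span_base matrix_products.single imageI)
  moreover have "?red W \<noteq> 0"
    using assms(3,4) W
    by (intro weighing_matrix_reduction_nonzero) (auto simp: mutually_unbiased_def)
  ultimately have "row_space (hblock (?red W) (mat 1)) \<in> ?C"
    by (intro CollectI exI[of _ "?red W"] exI[of _ 1]) auto
  then have code: "subspace_code ?C"
    by (auto simp: subspace_code_def row_space_def)
  have "row_space (hblock X (mat \<alpha>)) \<inter> euclidean_dual (row_space (hblock Y (mat \<beta>))) = {0}"
    if "X \<in> \<A>" "Y \<in> \<A>" "\<alpha> \<noteq> 0" "\<beta> \<noteq> 0" for X Y and \<alpha> \<beta> :: 'a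
  proof (rule row_space_Int_euclidean_dual)
    have "mat \<beta> ** mat \<alpha> = (mat (\<beta> * \<alpha>) :: 'a ^ 'n ^ 'n)"
      by (simp add: vec_eq_iff matrix_matrix_mult_def mat_def mult_delta_left)
    then show "hblock Y (mat \<beta>) ** transpose (hblock X (mat \<alpha>)) = mat (\<beta> * \<alpha>)"
      using orth[of Y X] that by (simp add: hblock_mult_transpose_hblock)
    show "\<beta> * \<alpha> \<noteq> 0"
      using that by simp
  qed
  then show ?thesis
    unfolding LCD_subspace_code_def using code by blast
qed

end
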